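(* $\psi=(\psi_{(S,R)})_{(S,R)\in \mathrm{Ob}\,\mathcal{E}}$, where $\psi_{(S,R)}:\mathrm{Spec}\,S\to\mathrm{Spec}\,R$, is a natural transformation from the contravariant functor $\mathrm{Spec}\circ W$ to the contravariant functor $\mathrm{Spec}\circ V$ (both from $\mathcal{E}$ to the category of topological spaces and continuous functions).
   Context: "Ring" means commutative ring, not necessarily with identity. Prime ideals are proper by definition. $\mathrm{Spec}\,S$ is the set of prime ideals of the ring $S$ with the Zariski topology, which has as a basis the sets $D_S(a)=\{P\in\mathrm{Spec}\,S: a\notin P\}$, $a\in S$. An i-extension of $S$ is a ring $R$ containing $S$ as an ideal. For an i-extension $R$ of $S$ and an ideal $I$ of $S$, put $\psi_{(S,R)}(I)=\{x\in R: xS\subseteq I\}$, an ideal of $R$. If $P$ is a prime ideal of $S$, then $\psi_{(S,R)}(P)$ is a prime ideal of $R$, and the resulting map $\psi_{(S,R)}:\mathrm{Spec}\,S\to\mathrm{Spec}\,R$ is injective, continuous, and open onto its image. $\mathcal{E}$ is the category whose objects are the pairs $(S,R)$ with $R$ a unitary ring that is an i-extension of the ring $S$, and whose morphisms $(S_1,R_1)\to(S_2,R_2)$ are the homomorphisms of unitary rings $h:R_1\to R_2$ such that $h(S_1)=S_2$. $V$ is the functor from $\mathcal{E}$ to unitary commutative rings sending $h:(S,R)\to(T,M)$ to $h:R\to M$. $W$ is the functor from $\mathcal{E}$ to the category of commutative rings and surjective homomorphisms sending $h:(S,R)\to(T,M)$ to $h|_S:S\to T$. $\mathrm{Spec}$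 acts contravariantly on unitary homomorphisms and on surjective homomorphisms by $P\mapsto h^{-1}(P)$. *)

theory Defs
  imports "HOL-Algebra.Ideal" "HOL-Analysis.Abstract_Topology"
begin

text \<open>
  Rings without identity are carried by the record type \<open>ring\<close> of \<open>HOL-Algebra\<close>; its field
  \<open>one\<close> is left unconstrained and is never referred to. For unitary rings the library
  locale \<open>cring\<close> is used, in which the zero ring is allowed.
\<close>

locale crng = abelian_group R for R (structure) +
  assumes m_closed: "\<lbrakk>x \<in> carrier R; y \<in> carrier R\<rbrakk> \<Longrightarrow> x \<otimes> y \<in> carrier R"
    and m_assoc: "\<lbrakk>x \<in> carrier R; y \<in> carrier R; z \<in> carrier R\<rbrakk>
      \<Longrightarrow> (x \<otimes> y) \<otimes> z = x \<otimes> (y \<otimes> z)"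
    and m_comm: "\<lbrakk>x \<in> carrier R; y \<in> carrier R\<rbrakk> \<Longrightarrow> x \<otimes> y = y \<otimes> x"
    and l_distr: "\<lbrakk>x \<in> carrier R; y \<in> carrier R; z \<in> carrier R\<rbrakk>
      \<Longrightarrow> (x \<oplus> y) \<otimes> z = x \<otimes> z \<oplus> y \<otimes> z"

definition rng_hom :: "('a, 'm) ring_scheme \<Rightarrow> ('b, 'n) ring_scheme \<Rightarrow> ('a \<Rightarrow> 'b) set" where
  "rng_hom R S = {h \<in> carrier R \<rightarrow> carrier S. \<forall>x\<in>carrier R. \<forall>y\<in>carrier R.
     h (x \<otimes>\<^bsub>R\<^esub> y) = h x \<otimes>\<^bsub>S\<^esub> h y \<and> h (x \<oplus>\<^bsub>R\<^esub> y) = h x \<oplus>\<^bsub>S\<^esub> h y}"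

definition rng_ideal :: "'a set \<Rightarrow> ('a, 'm) ring_scheme \<Rightarrow> bool" where
  "rng_ideal I R \<longleftrightarrow> additive_subgroup I R \<and> (\<forall>a\<in>I. \<forall>x\<in>carrier R. x \<otimes>\<^bsub>R\<^esub> a \<in> I)"

definition rng_prime_ideal :: "'a set \<Rightarrow> ('a, 'm) ring_scheme \<Rightarrow> bool" where
  "rng_prime_ideal P R \<longleftrightarrow> rng_ideal P R \<and> P \<noteq> carrier R \<and>
     (\<forall>a\<in>carrier R. \<forall>b\<in>carrier R. a \<otimes>\<^bsub>R\<^esub> b \<in> P \<longrightarrow> a \<in> P \<or> b \<in> P)"

lemma cring_imp_crng:
  assumes "cring R" shows "crng R"
proof -
  interpret cring R by fact
  show ?thesis
    by (intro crng.intro crng_axioms.intro is_abelian_group) (fact m_closed m_assoc m_comm l_distr)+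
qed

lemma rng_ideal_iff_ideal:
  assumes "cring R" shows "rng_ideal I R \<longleftrightarrow> ideal I R"
proof -
  interpret cring R by fact
  show ?thesis
  proof
    assume I: "rng_ideal I R"
    then interpret additive_subgroup I R by (simp add: rng_ideal_def)
    show "ideal I R"
      by unfold_locales (use I m_comm a_Hcarr in \<open>auto simp: rng_ideal_def\<close>)
  next
    assume "ideal I R"
    then interpret ideal I R .
    show "rng_ideal I R"
      by (simp add: rng_ideal_def is_additive_subgroup I_l_closed)
  qed
qed

lemma rng_prime_ideal_iff_primeideal:
  assumes "cring R" shows "rng_prime_ideal P R \<longleftrightarrow> primeideal P R"
  using assms rng_ideal_iff_ideal[OF assms, of P]
  unfolding rng_prime_ideal_def primeideal_def primeideal_axioms_def by blast

definition prime_ideals :: "('a, 'm) ring_scheme \<Rightarrow> 'a set set" where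
  "prime_ideals S = {P. rng_prime_ideal P S}"

definition basic_open :: "('a, 'm) ring_scheme \<Rightarrow> 'a \<Rightarrow> 'a set set" where
  "basic_open S a = {P \<in> prime_ideals S. a \<notin> P}"

definition Spec :: "('a, 'm) ring_scheme \<Rightarrow> 'a set topology" where
  "Spec S = topology (arbitrary union_of (\<lambda>U. \<exists>a\<in>carrier S. U = basic_open S a))"

lemma rng_prime_ideal_subset: "rng_prime_ideal P S \<Longrightarrow> P \<subseteq> carrier S"
  by (simp add: rng_prime_ideal_def rng_ideal_def additive_subgroup.a_subset)

lemma basic_open_mult:
  assumes "crng S" "a \<in> carrier S" "b \<in> carrier S"
  shows "basic_open S a \<inter> basic_open S b = basic_open S (a \<otimes>\<^bsub>S\<^esub> b)"
proof -
  interpret crng S by fact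
  have "a \<otimes>\<^bsub>S\<^esub> b \<in> P \<longleftrightarrow> a \<in> P \<or> b \<in> P" if "rng_prime_ideal P S" for P
    using that assms m_comm[of a b] unfolding rng_prime_ideal_def rng_ideal_def by metis
  then show ?thesis
    by (auto simp: basic_open_def prime_ideals_def)
qed

lemma openin_Spec:
  assumes "crng S"
  shows "openin (Spec S) = arbitrary union_of (\<lambda>U. \<exists>a\<in>carrier S. U = basic_open S a)"
proof -
  interpret crng S by fact
  have "istopology (arbitrary union_of (\<lambda>U. \<exists>a\<in>carrier S. U = basic_open S a))"
    by (rule istopology_base) (metis basic_open_mult[OF assms] m_closed)
  then show ?thesis
    by (simp add: Spec_def)
qed

lemma openin_basic_open:
  assumes "crng S" "a \<in> carrier S" shows "openin (Spec S) (basic_open S a)"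
  unfolding openin_Spec[OF assms(1)] using assms(2) by (intro union_of_inc) (auto simp: arbitrary_def)

lemma topspace_Spec:
  assumes "crng S" shows "topspace (Spec S) = prime_ideals S"
proof
  show "topspace (Spec S) \<subseteq> prime_ideals S"
    using openin_topspace[of "Spec S"]
    unfolding openin_Spec[OF assms] union_of_def basic_open_def by auto
  show "prime_ideals S \<subseteq> topspace (Spec S)"
  proof
    fix P assume P: "P \<in> prime_ideals S"
    then obtain a where a: "a \<in> carrier S" "a \<notin> P"
      using rng_prime_ideal_subset unfolding prime_ideals_def rng_prime_ideal_def by blast
    with P have "P \<in> basic_open S a" by (simp add: basic_open_def)
    then show "P \<in> topspace (Spec S)"
      using openin_subset[OF openin_basic_open[OF assms a(1)]] by blast
  qed
qed

text \<open>
  The hom-sets of different pairs of objects need not be disjoint: an arrow is always considered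
  together with its source and target, so \<open>Comp C X Y Z g f\<close> is the composite of
  \<open>f : X \<rightarrow> Y\<close> and \<open>g : Y \<rightarrow> Z\<close>. In the concrete categories below arrows are
  \<open>extensional\<close> functions, so that equality of arrows is equality on the carrier of the source.
\<close>

record ('o, 'm) category_data =
  Obj :: "'o set"
  Hom :: "'o \<Rightarrow> 'o \<Rightarrow> 'm set"
  Ident :: "'o \<Rightarrow> 'm"
  Comp :: "'o \<Rightarrow> 'o \<Rightarrow> 'o \<Rightarrow> 'm \<Rightarrow> 'm \<Rightarrow> 'm"

record ('o, 'm, 'p, 'n) functor_data =
  omap :: "'o \<Rightarrow> 'p"
  amap :: "'o \<Rightarrow> 'o \<Rightarrow> 'm \<Rightarrow> 'n"

locale category =
  fixes C :: "('o, 'm) category_data"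
  assumes Ident_in_Hom: "X \<in> Obj C \<Longrightarrow> Ident C X \<in> Hom C X X"
    and Comp_in_Hom: "\<lbrakk>X \<in> Obj C; Y \<in> Obj C; Z \<in> Obj C; f \<in> Hom C X Y; g \<in> Hom C Y Z\<rbrakk>
      \<Longrightarrow> Comp C X Y Z g f \<in> Hom C X Z"
    and Comp_Ident_right: "\<lbrakk>X \<in> Obj C; Y \<in> Obj C; f \<in> Hom C X Y\<rbrakk>
      \<Longrightarrow> Comp C X X Y f (Ident C X) = f"
    and Comp_Ident_left: "\<lbrakk>X \<in> Obj C; Y \<in> Obj C; f \<in> Hom C X Y\<rbrakk>
      \<Longrightarrow> Comp C X Y Y (Ident C Y) f = f"
    and Comp_assoc: "\<lbrakk>X \<in> Obj C; Y \<in> Obj C; Z \<in> Obj C; U \<in> Obj C;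
        f \<in> Hom C X Y; g \<in> Hom C Y Z; h \<in> Hom C Z U\<rbrakk>
      \<Longrightarrow> Comp C X Z U h (Comp C X Y Z g f) = Comp C X Y U (Comp C Y Z U h g) f"

locale covariant_functor = C: category C + D: category D
  for C :: "('o, 'm) category_data" and D :: "('p, 'n) category_data" +
  fixes F :: "('o, 'm, 'p, 'n) functor_data"
  assumes omap_in_Obj: "X \<in> Obj C \<Longrightarrow> omap F X \<in> Obj D"
    and amap_in_Hom: "\<lbrakk>X \<in> Obj C; Y \<in> Obj C; f \<in> Hom C X Y\<rbrakk>
      \<Longrightarrow> amap F X Y f \<in> Hom D (omap F X) (omap F Y)"
    and amap_Ident: "X \<in> Obj C \<Longrightarrow> amap F X X (Ident C X) = Ident D (omap F X)"
    and amap_Comp: "\<lbrakk>X \<in> Obj C; Y \<in> Obj C; Z \<in> Obj C; f \<in> Hom C X Y; g \<in> Hom C Y Z\<rbrakk>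
      \<Longrightarrow> amap F X Z (Comp C X Y Z g f) =
          Comp D (omap F X) (omap F Y) (omap F Z) (amap F Y Z g) (amap F X Y f)"

locale contravariant_functor = C: category C + D: category D
  for C :: "('o, 'm) category_data" and D :: "('p, 'n) category_data" +
  fixes F :: "('o, 'm, 'p, 'n) functor_data"
  assumes omap_in_Obj: "X \<in> Obj C \<Longrightarrow> omap F X \<in> Obj D"
    and amap_in_Hom: "\<lbrakk>X \<in> Obj C; Y \<in> Obj C; f \<in> Hom C X Y\<rbrakk>
      \<Longrightarrow> amap F X Y f \<in> Hom D (omap F Y) (omap F X)"
    and amap_Ident: "X \<in> Obj C \<Longrightarrow> amap F X X (Ident C X) = Ident D (omap F X)"
    and amap_Comp: "\<lbrakk>X \<in> Obj C; Y \<in> Obj C; Z \<in> Obj C; f \<in> Hom C X Y; g \<in> Hom C Y Z\<rbrakk>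
      \<Longrightarrow> amap F X Z (Comp C X Y Z g f) =
          Comp D (omap F Z) (omap F Y) (omap F X) (amap F X Y f) (amap F Y Z g)"

definition functor_comp ::
  "('p, 'n, 'q, 'k) functor_data \<Rightarrow> ('o, 'm, 'p, 'n) functor_data \<Rightarrow> ('o, 'm, 'q, 'k) functor_data"
  (infixl \<open>\<circ>\<^sub>F\<close> 55) where
  "G \<circ>\<^sub>F F = \<lparr>omap = \<lambda>X. omap G (omap F X),
             amap = \<lambda>X Y f. amap G (omap F X) (omap F Y) (amap F X Y f)\<rparr>"

locale contravariant_natural_transformation =
  F: contravariant_functor C D F + G: contravariant_functor C D G
  for C :: "('o, 'm) category_data" and D :: "('p, 'n) category_data"
    and F G :: "('o, 'm, 'p, 'n) functor_data" +
  fixes \<eta> :: "'o \<Rightarrow> 'n"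
  assumes component_in_Hom: "X \<in> Obj C \<Longrightarrow> \<eta> X \<in> Hom D (omap F X) (omap G X)"
    and naturality: "\<lbrakk>X \<in> Obj C; Y \<in> Obj C; f \<in> Hom C X Y\<rbrakk>
      \<Longrightarrow> Comp D (omap F Y) (omap F X) (omap G X) (\<eta> X) (amap F X Y f) =
          Comp D (omap F Y) (omap G Y) (omap G X) (amap G X Y f) (\<eta> Y)"

lemma contravariant_functor_comp:
  assumes "covariant_functor C D F" "contravariant_functor D E G"
  shows "contravariant_functor C E (G \<circ>\<^sub>F F)"
proof -
  interpret F: covariant_functor C D F by fact
  interpret G: contravariant_functor D E G by fact
  show ?thesis
    by unfold_locales
      (simp_all add: functor_comp_def F.omap_in_Obj F.amap_in_Hom F.amap_Ident F.amap_Comp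
        G.omap_in_Obj G.amap_in_Hom G.amap_Ident G.amap_Comp)
qed

definition CRing_cat :: "('a ring, 'a \<Rightarrow> 'a) category_data" where
  "CRing_cat = \<lparr>
     Obj = {R. cring R},
     Hom = \<lambda>R S. ring_hom R S \<inter> extensional (carrier R),
     Ident = \<lambda>R. \<lambda>x\<in>carrier R. x,
     Comp = \<lambda>R S T g f. compose (carrier R) g f\<rparr>"

definition CRng_surj_cat :: "('a ring, 'a \<Rightarrow> 'a) category_data" where
  "CRng_surj_cat = \<lparr>
     Obj = {R. crng R},
     Hom = \<lambda>R S. {h \<in> rng_hom R S \<inter> extensional (carrier R). h ` carrier R = carrier S},
     Ident = \<lambda>R. \<lambda>x\<in>carrier R. x,
     Comp = \<lambda>R S T g f. compose (carrier R) g f\<rparr>"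

definition Top_cat :: "('b topology, 'b \<Rightarrow> 'b) category_data" where
  "Top_cat = \<lparr>
     Obj = UNIV,
     Hom = \<lambda>X Y. {f. continuous_map X Y f} \<inter> extensional (topspace X),
     Ident = \<lambda>X. \<lambda>x\<in>topspace X. x,
     Comp = \<lambda>X Y Z g f. compose (topspace X) g f\<rparr>"

text \<open>\<open>i_extension S R\<close>: \<open>R\<close> contains \<open>S\<close>, with the operations of \<open>R\<close>, as an ideal.\<close>

definition i_extension :: "('a, 'm) ring_scheme \<Rightarrow> ('a, 'n) ring_scheme \<Rightarrow> bool" where
  "i_extension S R \<longleftrightarrow> crng S \<and> crng R \<and> rng_ideal (carrier S) R \<and> \<zero>\<^bsub>S\<^esub> = \<zero>\<^bsub>R\<^esub> \<and>
     (\<forall>x\<in>carrier S. \<forall>y\<in>carrier S. x \<oplus>\<^bsub>S\<^esub> y = x \<oplus>\<^bsub>R\<^esub> y \<and> x \<otimes>\<^bsub>S\<^esub> y = x \<otimes>\<^bsub>R\<^esub> y)"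

definition iext_cat :: "('a ring \<times> 'a ring, 'a \<Rightarrow> 'a) category_data" where
  "iext_cat = \<lparr>
     Obj = {(S, R). i_extension S R \<and> cring R},
     Hom = \<lambda>(S\<^sub>1, R\<^sub>1) (S\<^sub>2, R\<^sub>2).
       {h \<in> ring_hom R\<^sub>1 R\<^sub>2 \<inter> extensional (carrier R\<^sub>1). h ` carrier S\<^sub>1 = carrier S\<^sub>2},
     Ident = \<lambda>(S, R). \<lambda>x\<in>carrier R. x,
     Comp = \<lambda>(S\<^sub>1, R\<^sub>1) Y Z g f. compose (carrier R\<^sub>1) g f\<rparr>"

definition V_functor :: "('a ring \<times> 'a ring, 'a \<Rightarrow> 'a, 'a ring, 'a \<Rightarrow> 'a) functor_data" where
  "V_functor = \<lparr>omap = \<lambda>(S, R). R, amap = \<lambda>(S, R) (T, M) h. h\<rparr>"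

definition W_functor :: "('a ring \<times> 'a ring, 'a \<Rightarrow> 'a, 'a ring, 'a \<Rightarrow> 'a) functor_data" where
  "W_functor = \<lparr>omap = \<lambda>(S, R). S, amap = \<lambda>(S, R) (T, M) h. restrict h (carrier S)\<rparr>"

text \<open>The same data serves as a contravariant functor on \<open>CRing_cat\<close> and on \<open>CRng_surj_cat\<close>.\<close>

definition Spec_functor :: "('a ring, 'a \<Rightarrow> 'a, 'a set topology, 'a set \<Rightarrow> 'a set) functor_data" where
  "Spec_functor = \<lparr>omap = Spec,
     amap = \<lambda>S T h. \<lambda>P\<in>prime_ideals T. {x \<in> carrier S. h x \<in> P}\<rparr>"

definition psi :: "('a, 'm) ring_scheme \<Rightarrow> ('a, 'n) ring_scheme \<Rightarrow> 'a set \<Rightarrow> 'a set" where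
  "psi S R I = {x \<in> carrier R. \<forall>s\<in>carrier S. x \<otimes>\<^bsub>R\<^esub> s \<in> I}"

definition psi_transformation :: "'a ring \<times> 'a ring \<Rightarrow> 'a set \<Rightarrow> 'a set" where
  "psi_transformation = (\<lambda>(S, R). \<lambda>P\<in>prime_ideals S. psi S R P)"

lemma category_CRing_cat: "category CRing_cat"
proof unfold_locales
  fix X Y Z :: "'a ring" and f g :: "'a \<Rightarrow> 'a"
  assume X: "X \<in> Obj CRing_cat"
  then interpret cring X by (simp add: CRing_cat_def)
  show "Ident CRing_cat X \<in> Hom CRing_cat X X"
    by (auto simp: CRing_cat_def intro!: ring_hom_memI)
  assume "f \<in> Hom CRing_cat X Y" "g \<in> Hom CRing_cat Y Z"
  then show "Comp CRing_cat X Y Z g f \<in> Hom CRing_cat X Z"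
    by (auto simp: CRing_cat_def compose_def ring_hom_mult ring_hom_add ring_hom_one ring_hom_closed
        intro!: ring_hom_memI)
qed (auto simp: CRing_cat_def compose_def fun_eq_iff extensional_def restrict_def ring_hom_closed)

lemma crng_closed:
  assumes "crng R" "x \<in> carrier R" "y \<in> carrier R"
  shows "x \<otimes>\<^bsub>R\<^esub> y \<in> carrier R" "x \<oplus>\<^bsub>R\<^esub> y \<in> carrier R"
proof -
  interpret crng R by fact
  show "x \<otimes>\<^bsub>R\<^esub> y \<in> carrier R" "x \<oplus>\<^bsub>R\<^esub> y \<in> carrier R"
    using assms by (simp_all add: m_closed)
qed

lemma category_CRng_surj_cat: "category CRng_surj_cat"
proof unfold_locales
  fix X Y Z :: "'a ring" and f g :: "'a \<Rightarrow> 'a"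
  assume "X \<in> Obj CRng_surj_cat"
  then have X: "crng X" by (simp add: CRng_surj_cat_def)
  show "Ident CRng_surj_cat X \<in> Hom CRng_surj_cat X X"
    by (auto simp: CRng_surj_cat_def rng_hom_def crng_closed[OF X])
  assume fg: "f \<in> Hom CRng_surj_cat X Y" "g \<in> Hom CRng_surj_cat Y Z"
  then have f: "\<And>x. x \<in> carrier X \<Longrightarrow> f x \<in> carrier Y"
    by (auto simp: CRng_surj_cat_def)
  have "compose (carrier X) g f ` carrier X = g ` f ` carrier X"
    by (auto simp: compose_def image_image)
  then have "compose (carrier X) g f ` carrier X = carrier Z"
    using fg by (simp add: CRng_surj_cat_def)
  moreover have "compose (carrier X) g f \<in> rng_hom X Z"
    using fg f by (auto simp: CRng_surj_cat_def rng_hom_def compose_def crng_closed[OF X] Pi_iff)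
  ultimately show "Comp CRng_surj_cat X Y Z g f \<in> Hom CRng_surj_cat X Z"
    by (simp add: CRng_surj_cat_def)
qed (auto simp: CRng_surj_cat_def compose_def fun_eq_iff extensional_def restrict_def)

lemma category_Top_cat: "category Top_cat"
proof unfold_locales
  fix X Y Z :: "'a topology" and f g :: "'a \<Rightarrow> 'a"
  show "Ident Top_cat X \<in> Hom Top_cat X X"
    by (auto simp: Top_cat_def intro: continuous_map_eq[where f = "\<lambda>x. x"])
  assume "f \<in> Hom Top_cat X Y" "g \<in> Hom Top_cat Y Z"
  then show "Comp Top_cat X Y Z g f \<in> Hom Top_cat X Z"
    by (auto simp: Top_cat_def compose_def intro: continuous_map_eq[OF continuous_map_compose[of X Y f Z g]])
qed (auto simp: Top_cat_def compose_def fun_eq_iff extensional_def restrict_def Pi_iff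
  dest: continuous_map_funspace)

lemma i_extension_subset: "i_extension S R \<Longrightarrow> x \<in> carrier S \<Longrightarrow> x \<in> carrier R"
  unfolding i_extension_def rng_ideal_def using additive_subgroup.a_subset by blast

lemma category_iext_cat: "category iext_cat"
proof -
  interpret CRing: category CRing_cat by (rule category_CRing_cat)
  show ?thesis
  proof unfold_locales
    fix X Y Z :: "'a ring \<times> 'a ring" and f g :: "'a \<Rightarrow> 'a"
    obtain S R S1 R1 S2 R2 where XYZ: "X = (S, R)" "Y = (S1, R1)" "Z = (S2, R2)"
      by (cases X; cases Y; cases Z)
    assume X: "X \<in> Obj iext_cat"
    then have R: "R \<in> Obj CRing_cat" and sub: "\<And>x. x \<in> carrier S \<Longrightarrow> x \<in> carrier R"
      using i_extension_subset[of S R] by (auto simp: iext_cat_def CRing_cat_def XYZ)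
    have "(\<lambda>x\<in>carrier R. x) ` carrier S = carrier S"
      using sub by (auto simp: image_iff)
    then show "Ident iext_cat X \<in> Hom iext_cat X X"
      using CRing.Ident_in_Hom[OF R] by (simp add: iext_cat_def CRing_cat_def XYZ)
    assume Y: "Y \<in> Obj iext_cat" "Z \<in> Obj iext_cat"
      and f: "f \<in> Hom iext_cat X Y" and g: "g \<in> Hom iext_cat Y Z"
    have "compose (carrier R) g f ` carrier S = g ` f ` carrier S"
      using sub by (auto simp: compose_def image_iff)
    then have "compose (carrier R) g f ` carrier S = carrier S2"
      using f g by (simp add: iext_cat_def XYZ)
    then show "Comp iext_cat X Y Z g f \<in> Hom iext_cat X Z"
      using CRing.Comp_in_Hom[OF R, of R1 R2 f g] Y f g
      by (simp add: iext_cat_def CRing_cat_def XYZ)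
  qed (auto simp: iext_cat_def compose_def fun_eq_iff restrict_def extensional_def ring_hom_closed)
qed

lemma covariant_functor_V: "covariant_functor iext_cat CRing_cat V_functor"
  unfolding covariant_functor_def covariant_functor_axioms_def
  by (auto simp: category_iext_cat category_CRing_cat)
   (auto simp: V_functor_def iext_cat_def CRing_cat_def)

lemma covariant_functor_W: "covariant_functor iext_cat CRng_surj_cat W_functor"
  unfolding covariant_functor_def covariant_functor_axioms_def
proof (intro conjI allI impI category_iext_cat category_CRng_surj_cat)
  fix X Y Z :: "'a ring \<times> 'a ring" and f g :: "'a \<Rightarrow> 'a"
  obtain S R S1 R1 S2 R2 where XYZ: "X = (S, R)" "Y = (S1, R1)" "Z = (S2, R2)"
    by (cases X; cases Y; cases Z)
  assume X: "X \<in> Obj iext_cat" 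
  show "omap W_functor X \<in> Obj CRng_surj_cat"
    using X by (auto simp: XYZ W_functor_def iext_cat_def CRng_surj_cat_def i_extension_def)
  show "amap W_functor X X (Ident iext_cat X) = Ident CRng_surj_cat (omap W_functor X)"
    using X i_extension_subset[of S R]
    by (auto simp: XYZ W_functor_def iext_cat_def CRng_surj_cat_def fun_eq_iff)
  assume Y: "Y \<in> Obj iext_cat" and f: "f \<in> Hom iext_cat X Y"
  have sub: "\<And>x. x \<in> carrier S \<Longrightarrow> x \<in> carrier R"
    using X i_extension_subset[of S R] by (auto simp: iext_cat_def XYZ)
  have img: "f ` carrier S = carrier S1" and hom: "f \<in> ring_hom R R1"
    using f by (auto simp: iext_cat_def XYZ)
  then have fS: "\<And>x. x \<in> carrier S \<Longrightarrow> f x \<in> carrier S1" by auto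
  have eq: "i_extension S R" "i_extension S1 R1" using X Y by (auto simp: iext_cat_def XYZ)
  have "restrict f (carrier S) \<in> rng_hom S S1"
    using eq hom sub fS crng_closed[of S] unfolding rng_hom_def ring_hom_def i_extension_def
    by auto
  then show "amap W_functor X Y f \<in> Hom CRng_surj_cat (omap W_functor X) (omap W_functor Y)"
    using img by (auto simp: XYZ W_functor_def CRng_surj_cat_def)
  show "amap W_functor X Z (Comp iext_cat X Y Z g f) =
        Comp CRng_surj_cat (omap W_functor X) (omap W_functor Y) (omap W_functor Z)
          (amap W_functor Y Z g) (amap W_functor X Y f)"
    using fS sub by (auto simp: XYZ W_functor_def CRng_surj_cat_def iext_cat_def compose_def fun_eq_iff)
qed

lemma rng_prime_ideal_vimage:
  assumes "crng S" "crng T" "h \<in> rng_hom S T" "rng_prime_ideal P T"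
    and ne: "\<exists>x\<in>carrier S. h x \<notin> P"
  shows "rng_prime_ideal {x \<in> carrier S. h x \<in> P} S"
proof -
  interpret S: crng S by fact
  interpret T: crng T by fact
  interpret P: additive_subgroup P T
    using assms(4) by (simp add: rng_prime_ideal_def rng_ideal_def)
  have h: "\<And>x. x \<in> carrier S \<Longrightarrow> h x \<in> carrier T"
    "\<And>x y. \<lbrakk>x \<in> carrier S; y \<in> carrier S\<rbrakk> \<Longrightarrow> h (x \<oplus>\<^bsub>S\<^esub> y) = h x \<oplus>\<^bsub>T\<^esub> h y"
    "\<And>x y. \<lbrakk>x \<in> carrier S; y \<in> carrier S\<rbrakk> \<Longrightarrow> h (x \<otimes>\<^bsub>S\<^esub> y) = h x \<otimes>\<^bsub>T\<^esub> h y"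
    using assms(3) by (auto simp: rng_hom_def)
  interpret h: group_hom "add_monoid S" "add_monoid T" h
    by unfold_locales (auto simp: hom_def h)
  have "subgroup {x \<in> carrier S. h x \<in> P} (add_monoid S)"
  proof (rule S.add.subgroupI)
    show "{x \<in> carrier S. h x \<in> P} \<noteq> {}"
      using h.hom_one P.zero_closed by fastforce
    show "\<ominus>\<^bsub>S\<^esub> x \<in> {x \<in> carrier S. h x \<in> P}" if "x \<in> {x \<in> carrier S. h x \<in> P}" for x
      using that h.hom_inv[of x] h(1) P.a_inv_closed[of "h x"]
      by (simp add: a_inv_def[symmetric])
  qed (auto simp: h)
  then have "additive_subgroup {x \<in> carrier S. h x \<in> P} S"
    by (rule additive_subgroup.intro)
  with assms(4) ne show ?thesis
    unfolding rng_prime_ideal_def rng_ideal_def by (auto simp: h S.m_closed)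
qed

lemma continuous_map_Spec:
  assumes "crng S" "crng T"
    and F: "\<And>P. P \<in> prime_ideals S \<Longrightarrow> F P \<in> prime_ideals T"
    and ex: "\<And>a. a \<in> carrier T \<Longrightarrow> openin (Spec S) {P \<in> prime_ideals S. a \<notin> F P}"
  shows "continuous_map (Spec S) (Spec T) F"
proof (rule continuous_map_into_topology_base[OF openin_Spec[OF assms(2)]])
  show "F P \<in> topspace (Spec T)" if "P \<in> topspace (Spec S)" for P
    using that F by (simp add: topspace_Spec assms)
next
  fix U assume "\<exists>a\<in>carrier T. U = basic_open T a"
  then obtain a where a: "a \<in> carrier T" "U = basic_open T a" by blast
  have "{P \<in> topspace (Spec S). F P \<in> U} = {P \<in> prime_ideals S. a \<notin> F P}"
    using F a by (auto simp: topspace_Spec assms basic_open_def)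
  then show "openin (Spec S) {P \<in> topspace (Spec S). F P \<in> U}" using ex a by simp
qed

lemma Spec_arrow:
  assumes "crng S" "crng T" "h \<in> rng_hom S T"
    and ne: "\<And>P. rng_prime_ideal P T \<Longrightarrow> \<exists>x\<in>carrier S. h x \<notin> P"
  shows "amap Spec_functor S T h \<in> Hom Top_cat (Spec T) (Spec S)"
proof -
  have "continuous_map (Spec T) (Spec S) (\<lambda>P\<in>prime_ideals T. {x \<in> carrier S. h x \<in> P})"
  proof (rule continuous_map_Spec[OF assms(2,1)])
    fix P assume "P \<in> prime_ideals T"
    then show "(\<lambda>P\<in>prime_ideals T. {x \<in> carrier S. h x \<in> P}) P \<in> prime_ideals S"
      using rng_prime_ideal_vimage[OF assms(1-3) _ ne] by (simp add: prime_ideals_def)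
  next
    fix a assume a: "a \<in> carrier S"
    then have "{P \<in> prime_ideals T. a \<notin> (\<lambda>P\<in>prime_ideals T. {x \<in> carrier S. h x \<in> P}) P} = basic_open T (h a)"
      by (auto simp: basic_open_def)
    then show "openin (Spec T) {P \<in> prime_ideals T. a \<notin> (\<lambda>P\<in>prime_ideals T. {x \<in> carrier S. h x \<in> P}) P}"
      using openin_basic_open[OF assms(2), of "h a"] a assms(3) by (auto simp: rng_hom_def)
  qed
  then show ?thesis by (simp add: Top_cat_def Spec_functor_def topspace_Spec assms)
qed

lemma Spec_Ident:
  assumes "crng S"
  shows "amap Spec_functor S S (\<lambda>x\<in>carrier S. x) = Ident Top_cat (Spec S)"
proof
  fix P
  have "{x \<in> carrier S. (\<lambda>x\<in>carrier S. x) x \<in> P} = P" if "P \<subseteq> carrier S"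
    using that by auto
  moreover have "P \<subseteq> carrier S" if "P \<in> prime_ideals S"
    using that rng_prime_ideal_subset unfolding prime_ideals_def by blast
  ultimately show "amap Spec_functor S S (\<lambda>x\<in>carrier S. x) P = Ident Top_cat (Spec S) P"
    unfolding Top_cat_def Spec_functor_def functor_data.simps category_data.simps
      topspace_Spec[OF assms] restrict_def[where A = "prime_ideals S"]
    by presburger
qed

lemma Spec_Comp:
  assumes "crng S" "crng T" "crng U" "f \<in> rng_hom S T"
    and g: "amap Spec_functor T U g \<in> Hom Top_cat (Spec U) (Spec T)"
  shows "amap Spec_functor S U (compose (carrier S) g f) =
    Comp Top_cat (Spec U) (Spec T) (Spec S) (amap Spec_functor S T f) (amap Spec_functor T U g)"
proof
  fix P
  let ?Q = "{x \<in> carrier T. g x \<in> P}"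
  have "?Q \<in> prime_ideals T" if P: "P \<in> prime_ideals U"
  proof -
    have "amap Spec_functor T U g P \<in> topspace (Spec T)"
      using g P continuous_map_funspace[of "Spec U" "Spec T" "amap Spec_functor T U g"]
      by (auto simp: Top_cat_def topspace_Spec assms(1-3))
    then show ?thesis using P by (simp add: Spec_functor_def topspace_Spec assms(1-3))
  qed
  moreover have "{x \<in> carrier S. compose (carrier S) g f x \<in> P} = {x \<in> carrier S. f x \<in> ?Q}"
    using assms(4) by (auto simp: compose_def rng_hom_def)
  ultimately show "amap Spec_functor S U (compose (carrier S) g f) P =
    Comp Top_cat (Spec U) (Spec T) (Spec S) (amap Spec_functor S T f) (amap Spec_functor T U g) P"
    by (simp add: Top_cat_def Spec_functor_def topspace_Spec assms(1-3) compose_def)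
qed

lemma rng_hom_surj_notin:
  assumes "h ` carrier S = carrier T" "rng_prime_ideal P T"
  shows "\<exists>x\<in>carrier S. h x \<notin> P"
proof -
  have "\<not> carrier T \<subseteq> P"
    using rng_prime_ideal_subset[OF assms(2)] assms(2) by (auto simp: rng_prime_ideal_def)
  then show ?thesis unfolding assms(1)[symmetric] by blast
qed

lemma contravariant_functor_Spec_surj: "contravariant_functor CRng_surj_cat Top_cat Spec_functor"
proof -
  have arr: "amap Spec_functor S T h \<in> Hom Top_cat (Spec T) (Spec S)"
    if "S \<in> Obj CRng_surj_cat" "T \<in> Obj CRng_surj_cat" "h \<in> Hom CRng_surj_cat S T" for S T h
  proof -
    have "crng S" "crng T" "h \<in> rng_hom S T" and img: "h ` carrier S = carrier T"
      using that by (simp_all add: CRng_surj_cat_def)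
    then show ?thesis using rng_hom_surj_notin[OF img] by (intro Spec_arrow)
  qed
  show ?thesis
    unfolding contravariant_functor_def contravariant_functor_axioms_def
  proof (intro conjI allI impI category_CRng_surj_cat category_Top_cat)
    fix X Y Z :: "'a ring" and f g :: "'a \<Rightarrow> 'a"
    assume X: "X \<in> Obj CRng_surj_cat"
    show "omap Spec_functor X \<in> Obj Top_cat" by (simp add: Top_cat_def)
    show "amap Spec_functor X X (Ident CRng_surj_cat X) = Ident Top_cat (omap Spec_functor X)"
      using X Spec_Ident[of X] by (simp add: CRng_surj_cat_def Spec_functor_def)
    assume Y: "Y \<in> Obj CRng_surj_cat" and f: "f \<in> Hom CRng_surj_cat X Y"
    show "amap Spec_functor X Y f \<in> Hom Top_cat (omap Spec_functor Y) (omap Spec_functor X)"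
      using arr[OF X Y f] by (simp add: Spec_functor_def)
    assume Z: "Z \<in> Obj CRng_surj_cat" and g: "g \<in> Hom CRng_surj_cat Y Z"
    show "amap Spec_functor X Z (Comp CRng_surj_cat X Y Z g f) =
        Comp Top_cat (omap Spec_functor Z) (omap Spec_functor Y) (omap Spec_functor X)
          (amap Spec_functor X Y f) (amap Spec_functor Y Z g)"
      using Spec_Comp[of X Y Z f g] arr[OF Y Z g] X Y Z f
      by (simp add: CRng_surj_cat_def Spec_functor_def)
  qed
qed

lemma ring_hom_imp_rng_hom: "h \<in> ring_hom R S \<Longrightarrow> h \<in> rng_hom R S"
  by (auto simp: ring_hom_def rng_hom_def)

lemma contravariant_functor_Spec: "contravariant_functor CRing_cat Top_cat Spec_functor"
proof -
  have arr: "amap Spec_functor S T h \<in> Hom Top_cat (Spec T) (Spec S)"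
    if "S \<in> Obj CRing_cat" "T \<in> Obj CRing_cat" "h \<in> Hom CRing_cat S T" for S T h
  proof (rule Spec_arrow)
    from that have *: "cring S" "cring T" "h \<in> ring_hom S T" by (auto simp: CRing_cat_def)
    then show "crng S" "crng T" "h \<in> rng_hom S T"
      by (auto intro: cring_imp_crng ring_hom_imp_rng_hom)
    fix P assume "rng_prime_ideal P T"
    then interpret primeideal P T using * by (simp add: rng_prime_ideal_iff_primeideal)
    have "h \<one>\<^bsub>S\<^esub> \<notin> P" using I_notcarr one_imp_carrier ring_hom_one[OF *(3)] by auto
    moreover have "\<one>\<^bsub>S\<^esub> \<in> carrier S" using *(1) by (simp add: cring.cring_simprules)
    ultimately show "\<exists>x\<in>carrier S. h x \<notin> P" by blast
  qed
  show ?thesis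
    unfolding contravariant_functor_def contravariant_functor_axioms_def
  proof (intro conjI allI impI category_CRing_cat category_Top_cat)
    fix X Y Z :: "'a ring" and f g :: "'a \<Rightarrow> 'a"
    assume X: "X \<in> Obj CRing_cat"
    show "omap Spec_functor X \<in> Obj Top_cat" by (simp add: Top_cat_def)
    show "amap Spec_functor X X (Ident CRing_cat X) = Ident Top_cat (omap Spec_functor X)"
      using X Spec_Ident[of X] by (simp add: CRing_cat_def Spec_functor_def cring_imp_crng)
    assume Y: "Y \<in> Obj CRing_cat" and f: "f \<in> Hom CRing_cat X Y"
    show "amap Spec_functor X Y f \<in> Hom Top_cat (omap Spec_functor Y) (omap Spec_functor X)"
      using arr[OF X Y f] by (simp add: Spec_functor_def)
    assume Z: "Z \<in> Obj CRing_cat" and g: "g \<in> Hom CRing_cat Y Z"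
    show "amap Spec_functor X Z (Comp CRing_cat X Y Z g f) =
        Comp Top_cat (omap Spec_functor Z) (omap Spec_functor Y) (omap Spec_functor X)
          (amap Spec_functor X Y f) (amap Spec_functor Y Z g)"
      using Spec_Comp[of X Y Z f g] arr[OF Y Z g] X Y Z f
      by (simp add: CRing_cat_def Spec_functor_def cring_imp_crng ring_hom_imp_rng_hom)
  qed
qed

lemma psi_prime:
  assumes "i_extension S R" "cring R" "rng_prime_ideal P S"
  shows "rng_prime_ideal (psi S R P) R"
proof -
  interpret R: cring R by fact
  interpret S: crng S using assms by (simp add: i_extension_def)
  interpret P: additive_subgroup P S
    using assms(3) by (simp add: rng_prime_ideal_def rng_ideal_def)
  interpret SR: additive_subgroup "carrier S" R
    using assms by (simp add: i_extension_def rng_ideal_def)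
  have sub: "\<And>s. s \<in> carrier S \<Longrightarrow> s \<in> carrier R" by (rule SR.a_Hcarr)
  have cl: "\<And>x s. \<lbrakk>x \<in> carrier R; s \<in> carrier S\<rbrakk> \<Longrightarrow> x \<otimes>\<^bsub>R\<^esub> s \<in> carrier S"
    using assms by (simp add: i_extension_def rng_ideal_def)
  have op: "\<zero>\<^bsub>S\<^esub> = \<zero>\<^bsub>R\<^esub>" "\<And>x y. \<lbrakk>x \<in> carrier S; y \<in> carrier S\<rbrakk> \<Longrightarrow> x \<oplus>\<^bsub>S\<^esub> y = x \<oplus>\<^bsub>R\<^esub> y"
    "\<And>x y. \<lbrakk>x \<in> carrier S; y \<in> carrier S\<rbrakk> \<Longrightarrow> x \<otimes>\<^bsub>S\<^esub> y = x \<otimes>\<^bsub>R\<^esub> y"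
    using assms by (auto simp: i_extension_def)
  have neg: "\<ominus>\<^bsub>S\<^esub> x = \<ominus>\<^bsub>R\<^esub> x" if "x \<in> carrier S" for x
    using that op(1) op(2)[of "\<ominus>\<^bsub>S\<^esub> x" x] sub[of x] sub[of "\<ominus>\<^bsub>S\<^esub> x"] S.l_neg[OF that]
    by (metis R.minus_equality S.a_inv_closed)
  have Pp: "\<And>a b. \<lbrakk>a \<in> carrier S; b \<in> carrier S; a \<otimes>\<^bsub>S\<^esub> b \<in> P\<rbrakk> \<Longrightarrow> a \<in> P \<or> b \<in> P"
    "\<And>a b. \<lbrakk>a \<in> P; b \<in> carrier S\<rbrakk> \<Longrightarrow> b \<otimes>\<^bsub>S\<^esub> a \<in> P" "P \<noteq> carrier S"
    using assms(3) by (auto simp: rng_prime_ideal_def rng_ideal_def)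
  have Padd: "\<And>a b. \<lbrakk>a \<in> P; b \<in> P\<rbrakk> \<Longrightarrow> a \<oplus>\<^bsub>R\<^esub> b \<in> P"
    using op(2) P.a_Hcarr P.a_closed by metis
  have Pneg: "\<And>a. a \<in> P \<Longrightarrow> \<ominus>\<^bsub>R\<^esub> a \<in> P"
    using neg P.a_Hcarr P.a_inv_closed by metis
  have "subgroup (psi S R P) (add_monoid R)"
  proof (rule R.add.subgroupI)
    show "psi S R P \<subseteq> carrier R" by (auto simp: psi_def)
    have "\<zero>\<^bsub>R\<^esub> \<in> psi S R P" using P.zero_closed op(1) sub by (auto simp: psi_def)
    then show "psi S R P \<noteq> {}" by blast
    show "\<ominus>\<^bsub>R\<^esub> a \<in> psi S R P" if "a \<in> psi S R P" for a
      using that Pneg sub by (auto simp: psi_def a_inv_def[symmetric] R.l_minus)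
    show "a \<oplus>\<^bsub>R\<^esub> b \<in> psi S R P" if "a \<in> psi S R P" "b \<in> psi S R P" for a b
      using that Padd sub by (auto simp: psi_def R.l_distr)
  qed
  then have "additive_subgroup (psi S R P) R" by (rule additive_subgroup.intro)
  moreover have "x \<otimes>\<^bsub>R\<^esub> a \<in> psi S R P" if "a \<in> psi S R P" "x \<in> carrier R" for a x
  proof -
    have "(x \<otimes>\<^bsub>R\<^esub> a) \<otimes>\<^bsub>R\<^esub> s = a \<otimes>\<^bsub>R\<^esub> (x \<otimes>\<^bsub>R\<^esub> s)" if "s \<in> carrier S" for s
      using that \<open>a \<in> psi S R P\<close> \<open>x \<in> carrier R\<close> sub by (simp add: psi_def R.m_ac)
    moreover have "a \<otimes>\<^bsub>R\<^esub> (x \<otimes>\<^bsub>R\<^esub> s) \<in> P" if "s \<in> carrier S" for s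
      using \<open>a \<in> psi S R P\<close> cl[OF \<open>x \<in> carrier R\<close> that] by (simp add: psi_def)
    moreover have "x \<otimes>\<^bsub>R\<^esub> a \<in> carrier R"
      using that by (simp add: psi_def)
    ultimately show ?thesis unfolding psi_def by auto
  qed
  moreover have "\<one>\<^bsub>R\<^esub> \<notin> psi S R P"
    using Pp(3) sub P.a_subset by (auto simp: psi_def)
  moreover have "a \<in> psi S R P \<or> b \<in> psi S R P"
    if ab: "a \<in> carrier R" "b \<in> carrier R" "a \<otimes>\<^bsub>R\<^esub> b \<in> psi S R P" for a b
  proof (rule ccontr)
    assume "\<not> ?thesis"
    then obtain s t where st: "s \<in> carrier S" "t \<in> carrier S" "a \<otimes>\<^bsub>R\<^esub> s \<notin> P" "b \<otimes>\<^bsub>R\<^esub> t \<notin> P"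
      using ab by (auto simp: psi_def)
    have "(a \<otimes>\<^bsub>R\<^esub> s) \<otimes>\<^bsub>S\<^esub> (b \<otimes>\<^bsub>R\<^esub> t) = (a \<otimes>\<^bsub>R\<^esub> b) \<otimes>\<^bsub>R\<^esub> (s \<otimes>\<^bsub>R\<^esub> t)"
      using ab st sub op(3) cl by (simp add: R.m_ac)
    moreover have "s \<otimes>\<^bsub>R\<^esub> t \<in> carrier S" using cl sub st by simp
    then have "(a \<otimes>\<^bsub>R\<^esub> b) \<otimes>\<^bsub>R\<^esub> (s \<otimes>\<^bsub>R\<^esub> t) \<in> P"
      using ab(3) by (simp add: psi_def)
    ultimately have "(a \<otimes>\<^bsub>R\<^esub> s) \<otimes>\<^bsub>S\<^esub> (b \<otimes>\<^bsub>R\<^esub> t) \<in> P"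
      by (simp only:)
    then show False
      using Pp(1)[OF cl[OF ab(1) st(1)] cl[OF ab(2) st(2)]] st(3,4) by blast
  qed
  ultimately show ?thesis
    unfolding rng_prime_ideal_def rng_ideal_def using R.one_closed by (intro conjI) blast+
qed

end

theory Submission
  imports Defs
begin

text \<open>Naturality for \<open>h\<close> from \<open>(S, R)\<close> to \<open>(T, M)\<close>
  compares two primes of \<open>R\<close> attached to a prime \<open>P\<close> of \<open>T\<close>.
  Membership of \<open>x\<close> means \<open>h (x s) \<in> P\<close> for all \<open>s\<close> in
  \<open>S\<close> on one side, and \<open>h x t \<in> P\<close> for all \<open>t\<close> in
  \<open>T\<close> on the other. As \<open>h\<close> is multiplicative and maps \<open>S\<close>
  onto \<open>T\<close>, these conditions agree (\<open>psi_vimage\<close>). Each component is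
  continuous because it pulls basic open sets back to unions of basic open sets
  (\<open>psi_transformation_in_Hom\<close>). Functoriality of both composites comes from that of
  their factors.\<close>

lemma psi_notin_iff:
  assumes "a \<in> carrier R"
  shows "a \<notin> psi S R P \<longleftrightarrow> (\<exists>s\<in>carrier S. a \<otimes>\<^bsub>R\<^esub> s \<notin> P)"
  using assms by (simp add: psi_def)

lemma psi_transformation_in_Hom:
  assumes "i_extension S R" "cring R"
  shows "psi_transformation (S, R) \<in> Hom Top_cat (Spec S) (Spec R)"
proof -
  have S: "crng S" and R: "crng R"
    and cl: "\<And>a s. \<lbrakk>a \<in> carrier R; s \<in> carrier S\<rbrakk> \<Longrightarrow> a \<otimes>\<^bsub>R\<^esub> s \<in> carrier S"
    using assms by (auto simp: i_extension_def rng_ideal_def)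
  have "continuous_map (Spec S) (Spec R) (psi_transformation (S, R))"
  proof (rule continuous_map_Spec[OF S R])
    show "psi_transformation (S, R) P \<in> prime_ideals R" if "P \<in> prime_ideals S" for P
      using that psi_prime[OF assms, of P] by (simp add: psi_transformation_def prime_ideals_def)
  next
    fix a assume a: "a \<in> carrier R"
    \<comment> \<open>The preimage of \<open>basic_open R a\<close> is the union of the sets
      \<open>basic_open S (a s)\<close>; each product \<open>a s\<close> lies in \<open>S\<close>
      because \<open>S\<close> is an ideal of \<open>R\<close>.\<close>
    have "{P \<in> prime_ideals S. a \<notin> psi_transformation (S, R) P} =
        (\<Union>s\<in>carrier S. basic_open S (a \<otimes>\<^bsub>R\<^esub> s))"
      by (auto simp: psi_transformation_def psi_notin_iff[OF a] basic_open_def)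
    then show "openin (Spec S) {P \<in> prime_ideals S. a \<notin> psi_transformation (S, R) P}"
      using a cl by (auto intro!: openin_Union openin_basic_open[OF S])
  qed
  then show ?thesis
    by (simp add: Top_cat_def topspace_Spec[OF S] psi_transformation_def)
qed

text \<open>The left side also asks that \<open>x s\<close> lie in \<open>S\<close>, which is
  automatic since \<open>S\<close> is an ideal of \<open>R\<close>. Primality of \<open>P\<close> is
  irrelevant to this identity.\<close>

lemma psi_vimage:
  assumes "i_extension S R" "h \<in> ring_hom R M" "h ` carrier S = carrier T"
  shows "psi S R {x \<in> carrier S. h x \<in> P} = {x \<in> carrier R. h x \<in> psi T M P}"
proof -
  have cl: "\<And>x s. \<lbrakk>x \<in> carrier R; s \<in> carrier S\<rbrakk> \<Longrightarrow> x \<otimes>\<^bsub>R\<^esub> s \<in> carrier S"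
    using assms(1) by (simp add: i_extension_def rng_ideal_def)
  have "h (x \<otimes>\<^bsub>R\<^esub> s) = h x \<otimes>\<^bsub>M\<^esub> h s" if "x \<in> carrier R" "s \<in> carrier S" for x s
    using that ring_hom_mult[OF assms(2)] i_extension_subset[OF assms(1)] by blast
  \<comment> \<open>Rewriting \<open>carrier T\<close> as the image of \<open>carrier S\<close>
    turns the quantifier over \<open>T\<close> into one over \<open>S\<close>.\<close>
  then show ?thesis
    using cl ring_hom_closed[OF assms(2)]
    by (auto simp: psi_def assms(3)[symmetric])
qed

theorem proposition10:
  shows "contravariant_natural_transformation
    (iext_cat :: ('a ring \<times> 'a ring, 'a \<Rightarrow> 'a) category_data)
    (Top_cat :: ('a set topology, 'a set \<Rightarrow> 'a set) category_data)
    (Spec_functor \<circ>\<^sub>F W_functor) (Spec_functor \<circ>\<^sub>F V_functor) psi_transformation"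
proof -
  let ?F = "Spec_functor \<circ>\<^sub>F W_functor ::
    ('a ring \<times> 'a ring, 'a \<Rightarrow> 'a, 'a set topology, 'a set \<Rightarrow> 'a set) functor_data"
  let ?G = "Spec_functor \<circ>\<^sub>F V_functor ::
    ('a ring \<times> 'a ring, 'a \<Rightarrow> 'a, 'a set topology, 'a set \<Rightarrow> 'a set) functor_data"
  interpret F: contravariant_functor iext_cat Top_cat ?F
    by (rule contravariant_functor_comp[OF covariant_functor_W contravariant_functor_Spec_surj])
  interpret G: contravariant_functor iext_cat Top_cat ?G
    by (rule contravariant_functor_comp[OF covariant_functor_V contravariant_functor_Spec])
  show ?thesis
  proof unfold_locales
    fix X :: "'a ring \<times> 'a ring"
    assume "X \<in> Obj iext_cat"
    then show "psi_transformation X \<in> Hom Top_cat (omap ?F X) (omap ?G X)"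
      using psi_transformation_in_Hom
      by (auto simp: iext_cat_def functor_comp_def Spec_functor_def V_functor_def W_functor_def)
  next
    fix X Y :: "'a ring \<times> 'a ring" and f :: "'a \<Rightarrow> 'a"
    assume X: "X \<in> Obj iext_cat" and Y: "Y \<in> Obj iext_cat" and f: "f \<in> Hom iext_cat X Y"
    obtain S R T M where XY: "X = (S, R)" "Y = (T, M)"
      by (cases X; cases Y)
    have ext: "i_extension S R" "i_extension T M" "cring R" "cring M"
      and h: "f \<in> ring_hom R M" and img: "f ` carrier S = carrier T"
      using X Y f by (auto simp: iext_cat_def XY)
    have S: "crng S" and T: "crng T"
      using ext by (auto simp: i_extension_def)
    let ?p = "\<lambda>P. {x \<in> carrier S. f x \<in> P}"
    \<comment> \<open>\<open>W_functor\<close> restricts \<open>f\<close> to \<open>S\<close>, but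
      the preimage is taken inside \<open>S\<close> anyway, so the restriction drops out.\<close>
    have Ff: "amap ?F X Y f = (\<lambda>P\<in>prime_ideals T. ?p P)"
      by (auto simp: XY functor_comp_def Spec_functor_def W_functor_def fun_eq_iff)
    have Gf: "amap ?G X Y f = (\<lambda>P\<in>prime_ideals M. {x \<in> carrier R. f x \<in> P})"
      by (simp add: XY functor_comp_def Spec_functor_def V_functor_def)
    have FY: "topspace (omap ?F Y) = prime_ideals T"
      by (simp add: XY functor_comp_def Spec_functor_def W_functor_def topspace_Spec T)
    have FX: "topspace (omap ?F X) = prime_ideals S"
      by (simp add: XY functor_comp_def Spec_functor_def W_functor_def topspace_Spec S)
    \<comment> \<open>Facts \<open>p\<close> and \<open>q\<close> ensure that the inner values lie
      where the outer restricted functions are not \<open>undefined\<close>. Here primality,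
      including properness, is read off from the functor law for \<open>?F\<close>.\<close>
    have p: "?p P \<in> prime_ideals S" if "P \<in> prime_ideals T" for P
    proof -
      have "amap ?F X Y f P \<in> topspace (omap ?F X)"
        using F.amap_in_Hom[OF X Y f] that continuous_map_funspace
        by (fastforce simp: Top_cat_def FY)
      then show ?thesis
        using that by (simp add: Ff FX)
    qed
    have q: "psi T M P \<in> prime_ideals M" if "P \<in> prime_ideals T" for P
      using that psi_prime[OF ext(2,4)] by (simp add: prime_ideals_def)
    have "psi_transformation X (amap ?F X Y f P) = amap ?G X Y f (psi_transformation Y P)"
      if "P \<in> prime_ideals T" for P
      using that p q psi_vimage[OF ext(1) h img, of P] unfolding Ff Gf
      by (simp add: XY psi_transformation_def)
    \<comment> \<open>Both composites are extensional on the prime ideals of \<open>T\<close>, so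
      agreement there suffices.\<close>
    then show "Comp Top_cat (omap ?F Y) (omap ?F X) (omap ?G X) (psi_transformation X) (amap ?F X Y f) =
        Comp Top_cat (omap ?F Y) (omap ?G Y) (omap ?G X) (amap ?G X Y f) (psi_transformation Y)"
      by (simp add: Top_cat_def compose_def FY cong: restrict_cong)
  qed
qed

end
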